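(* Let $X$ and $Y$ be path-connected CW spaces and let $f\colon X\to Y$ be a map. Then $$\operatorname{TC}_n(f)\le \operatorname{TC}_{n+1}(f)\le \operatorname{cat}(f^{n+1})\le (n+1)\operatorname{cat}(f)$$ for all $n\ge 2$, where $f^{n+1}=f\times\cdots\times f\colon X^{n+1}\to Y^{n+1}$. In particular, the growth of $\operatorname{TC}_n(f)$ is linear with respect to $n$.
   Context: All maps are continuous, and all pairs of spaces are assumed to be CW pairs. LS category of a map: for a map $h\colon P\to Q$, $\operatorname{cat}(h)$ is the least non-negative integer $k$ such that $P$ can be covered by $k+1$ open subsets on each of which the restriction of $h$ is null-homotopic (as a map to $Q$); it is $\infty$ if no such $k$ exists. Quasi-strong LS category: for a map of pairs $h\colon (B,C)\to (P,A)$, $\operatorname{qscat}(h)$ is the least non-negative integer $m$ such that $B$ can be covered by open sets $V_0,\dots,V_m$ such that for each $i$ there is a homotopy $H_i\colon V_i\times[0,1]\to P$ with $H_i(-,1)=h|_{V_i}$ and $H_i(V_i,0)\subseteq A$ (and $\infty$ if no such $m$ exists). Topological complexity of a map: let $X,Y$ be path-connected spaces, $f\colon X\to Y$ a map, and $n\ge 2$. Let $\Delta_n\colon X\to X^n$, $x\mapsto (x,\dots,x)$, be the diagonal map, and similarly for $Y$. Let $f^n=f\times\cdots\times f\colon X^n\to Y^n$ and let $\overline{f^n}\colon (X^n,\Delta_n(X))\to (Y^n,\Delta_n(Y))$ be the induced map of pairs. Then $\operatorname{TC}_n(f):=\operatorname{qscat}(\overline{f^n})$. *)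

theory Defs
  imports "HOL-Analysis.Analysis" "HOL-Library.Landau_Symbols"
    "HOL-Library.Extended_Nat"
begin

section \<open>CW spaces\<close>

definition unit_disk :: "nat \<Rightarrow> (nat \<Rightarrow> real) topology" where
  "unit_disk n = subtopology (Euclidean_space n) {x. (\<Sum>i<n. x i ^ 2) \<le> 1}"

definition open_unit_disk :: "nat \<Rightarrow> (nat \<Rightarrow> real) topology" where
  "open_unit_disk n = subtopology (Euclidean_space n) {x. (\<Sum>i<n. x i ^ 2) < 1}"

definition disk_boundary :: "nat \<Rightarrow> (nat \<Rightarrow> real) set" where
  "disk_boundary n = {x \<in> topspace (Euclidean_space n). (\<Sum>i<n. x i ^ 2) = 1}"

text \<open>
  A CW structure in Whitehead's sense. \<open>E\<close> is the set of open cells, \<open>d e\<close> the dimension of the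
  cell \<open>e\<close> and \<open>\<Phi> e\<close> its characteristic map. Neither the number of cells nor their dimensions are
  bounded. The last two conditions are closure finiteness and the weak topology.
\<close>

definition CW_structure ::
  "'a topology \<Rightarrow> 'a set set \<Rightarrow> ('a set \<Rightarrow> nat) \<Rightarrow> ('a set \<Rightarrow> (nat \<Rightarrow> real) \<Rightarrow> 'a) \<Rightarrow> bool" where
  "CW_structure X E d \<Phi> \<longleftrightarrow>
     Hausdorff_space X \<and>
     \<Union>E = topspace X \<and> disjoint E \<and>
     (\<forall>e\<in>E. continuous_map (unit_disk (d e)) X (\<Phi> e) \<and>
            homeomorphic_map (open_unit_disk (d e)) (subtopology X e) (\<Phi> e)) \<and>
     (\<forall>e\<in>E. \<exists>F\<subseteq>E. finite F \<and> (\<forall>e'\<in>F. d e' < d e) \<and> \<Phi> e ` disk_boundary (d e) \<subseteq> \<Union>F) \<and>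
     (\<forall>A\<subseteq>topspace X. closedin X A \<longleftrightarrow> (\<forall>e\<in>E. closedin X (A \<inter> X closure_of e)))"

definition CW_space :: "'a topology \<Rightarrow> bool" where
  "CW_space X \<longleftrightarrow> (\<exists>E d \<Phi>. CW_structure X E d \<Phi>)"

section \<open>LS category of a map and quasi-strong LS category of a map of pairs\<close>

definition null_homotopic :: "'a topology \<Rightarrow> 'b topology \<Rightarrow> ('a \<Rightarrow> 'b) \<Rightarrow> bool" where
  "null_homotopic P Q h \<longleftrightarrow> (\<exists>c. homotopic_with (\<lambda>_. True) P Q h (\<lambda>_. c))"

text \<open>The infimum of the empty set is \<open>\<infinity>\<close> in \<^typ>\<open>enat\<close>; a nonempty set attains it.\<close>

definition LS_cat :: "'a topology \<Rightarrow> 'b topology \<Rightarrow> ('a \<Rightarrow> 'b) \<Rightarrow> enat" where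
  "LS_cat P Q h = Inf {enat k | k. \<exists>U :: nat \<Rightarrow> 'a set.
     (\<forall>i\<le>k. openin P (U i) \<and> null_homotopic (subtopology P (U i)) Q h) \<and>
     (\<Union>i\<le>k. U i) = topspace P}"

text \<open>
  For a map of pairs \<open>h\<close> from \<open>(B, C)\<close> to \<open>(P, A)\<close>. The value does not depend on the subspace \<open>C\<close>,
  which is kept only as part of the source pair.
\<close>

definition qscat ::
  "'a topology \<Rightarrow> 'a set \<Rightarrow> 'b topology \<Rightarrow> 'b set \<Rightarrow> ('a \<Rightarrow> 'b) \<Rightarrow> enat" where
  "qscat B C P A h = Inf {enat m | m. \<exists>V :: nat \<Rightarrow> 'a set.
     (\<forall>i\<le>m. openin B (V i) \<and>
        (\<exists>H. continuous_map
               (prod_topology (subtopology B (V i)) (top_of_set {0..1::real})) P H \<and>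
             (\<forall>v\<in>V i. H (v, 1) = h v \<and> H (v, 0) \<in> A))) \<and>
     (\<Union>i\<le>m. V i) = topspace B}"

section \<open>Powers and topological complexity\<close>

text \<open>Points of the \<open>n\<close>-th power are functions on \<open>{..<n}\<close>, extended by \<open>undefined\<close> elsewhere.\<close>

definition power_space :: "nat \<Rightarrow> 'a topology \<Rightarrow> (nat \<Rightarrow> 'a) topology" where
  "power_space n X = product_topology (\<lambda>_. X) {..<n}"

definition power_map :: "nat \<Rightarrow> ('a \<Rightarrow> 'b) \<Rightarrow> (nat \<Rightarrow> 'a) \<Rightarrow> (nat \<Rightarrow> 'b)" where
  "power_map n f = (\<lambda>x. \<lambda>i\<in>{..<n}. f (x i))"

definition diagonal_map :: "nat \<Rightarrow> 'a \<Rightarrow> (nat \<Rightarrow> 'a)" where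
  "diagonal_map n x = (\<lambda>i\<in>{..<n}. x)"

text \<open>Meant for path-connected \<open>X\<close>, \<open>Y\<close>, a continuous \<open>f\<close> and \<open>n \<ge> 2\<close>.\<close>

definition TC :: "nat \<Rightarrow> 'a topology \<Rightarrow> 'b topology \<Rightarrow> ('a \<Rightarrow> 'b) \<Rightarrow> enat" where
  "TC n X Y f =
     qscat (power_space n X) (diagonal_map n ` topspace X)
           (power_space n Y) (diagonal_map n ` topspace Y) (power_map n f)"

end

theory Submission
  imports Defs
begin

text \<open>A motion planner for \<open>n + 1\<close> points gives one for \<open>n\<close> points by repeating a coordinate, and a
  null-homotopy into a path-connected power can be prolonged so that it ends on the diagonal; this
  gives the first two inequalities. The product inequality must avoid the topology of
  \<open>X\<^sup>n\<close>, which need not be a CW space. Partial sums of bump functions on the normal space \<open>X\<close> turn a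
  categorical cover by \<open>k + 1\<close> sets into arbitrarily many categorical open sets \<open>V\<^sub>j\<close> such that each
  point misses at most \<open>k\<close> of them. By counting, the powers of any \<open>n k + 1\<close> of the \<open>V\<^sub>j\<close>
  cover \<open>X\<^sup>n\<close>.\<close>

section \<open>Normality of CW spaces\<close>

lemma compact_space_unit_disk: "compact_space (unit_disk n)"
proof -
  \<comment> \<open>Tychonoff: the disk is a closed subset of this compact cube, whose coordinates
    from \<open>n\<close> on are frozen at 0.\<close>
  let ?B = "PiE UNIV (\<lambda>i. if i < n then {-1..1::real} else {0})"
  let ?S = "{x \<in> topspace (Euclidean_space n). (\<Sum>i<n. x i ^ 2) \<le> 1}"
  have "compactin (powertop_real UNIV) ?B"
    by (simp add: compactin_PiE)
  moreover have "closed {x::nat \<Rightarrow> real. (\<Sum>i<n. x i ^ 2) \<le> 1}"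
    by (intro closed_Collect_le continuous_intros) (simp_all add: continuous_on_product_coordinates)
  then have "closedin (powertop_real UNIV) ?S"
    using closedin_Euclidean_space[of n]
    by (simp add: closed_Int Collect_conj_eq euclidean_product_topology)
  moreover have "?S \<subseteq> ?B"
  proof
    fix x assume x: "x \<in> ?S"
    have "\<bar>x i\<bar> \<le> 1" if "i < n" for i
    proof -
      have "x i ^ 2 \<le> (\<Sum>i<n. x i ^ 2)"
        by (rule member_le_sum) (use that in auto)
      with x have "x i ^ 2 \<le> 1" by simp
      then show ?thesis by (simp only: abs_square_le_1)
    qed
    with x show "x \<in> ?B" by (auto simp: topspace_Euclidean_space abs_le_iff minus_le_iff)
  qed
  ultimately have "compactin (powertop_real UNIV) ?S"
    by (meson closed_compactin)
  then have "compact_space (subtopology (powertop_real UNIV) ?S)"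
    by (rule compact_space_subtopology)
  moreover have "unit_disk n = subtopology (powertop_real UNIV) ?S"
    by (simp add: unit_disk_def Euclidean_space_def subtopology_subtopology Collect_conj_eq)
  ultimately show ?thesis by simp
qed

lemma normal_space_unit_disk: "normal_space (unit_disk n)"
  by (intro compact_Hausdorff_or_regular_imp_normal_space disjI1 compact_space_unit_disk)
     (simp add: unit_disk_def Hausdorff_Euclidean_space Hausdorff_space_subtopology)

lemma closedin_disk_boundary: "closedin (unit_disk n) (disk_boundary n)"
proof -
  have "closed {x::nat \<Rightarrow> real. (\<Sum>i<n. x i ^ 2) = 1}"
    by (intro closed_Collect_eq continuous_intros) (simp_all add: continuous_on_product_coordinates)
  moreover have "closed (topspace (Euclidean_space n))"
    using closedin_Euclidean_space[of n] by (simp add: euclidean_product_topology)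
  ultimately have "closedin (Euclidean_space n) (disk_boundary n)"
    unfolding closedin_Euclidean_space_iff disk_boundary_def by (auto simp: Collect_conj_eq)
  then show ?thesis
    unfolding unit_disk_def by (rule closedin_subset_topspace) (auto simp: disk_boundary_def)
qed

lemma topspace_unit_disk: "topspace (unit_disk n) = topspace (open_unit_disk n) \<union> disk_boundary n"
  by (auto simp: unit_disk_def open_unit_disk_def disk_boundary_def)

section \<open>Cells, and cellwise tests for closedness and continuity\<close>

locale CW =
  fixes X :: "'a topology" and E :: "'a set set" and d :: "'a set \<Rightarrow> nat"
    and \<Phi> :: "'a set \<Rightarrow> (nat \<Rightarrow> real) \<Rightarrow> 'a"
  assumes CW: "CW_structure X E d \<Phi>"
begin

lemma continuous_characteristic_map: "e \<in> E \<Longrightarrow> continuous_map (unit_disk (d e)) X (\<Phi> e)"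
  and cell_homeomorphism:
    "e \<in> E \<Longrightarrow> homeomorphic_map (open_unit_disk (d e)) (subtopology X e) (\<Phi> e)"
  and Hausdorff: "Hausdorff_space X"
  and Union_cells: "\<Union>E = topspace X"
  and disjoint_cells: "disjoint E"
  and attaching_finite:
    "\<forall>e\<in>E. \<exists>F\<subseteq>E. finite F \<and> (\<forall>e'\<in>F. d e' < d e) \<and> \<Phi> e ` disk_boundary (d e) \<subseteq> \<Union>F"
  and weak_topology:
    "A \<subseteq> topspace X \<Longrightarrow> closedin X A \<longleftrightarrow> (\<forall>e\<in>E. closedin X (A \<inter> X closure_of e))"
  using CW unfolding CW_structure_def by simp_all

lemma cell_unique: "\<lbrakk>e \<in> E; e' \<in> E; x \<in> e; x \<in> e'\<rbrakk> \<Longrightarrow> e = e'"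
  using disjoint_cells by (auto simp: disjoint_def)

lemma closure_finite:
  assumes "e \<in> E"
  obtains F where "F \<subseteq> E" "finite F" "\<forall>e'\<in>F. d e' < d e" "\<Phi> e ` disk_boundary (d e) \<subseteq> \<Union>F"
  using bspec[OF attaching_finite assms] by (elim exE conjE) (rule that)

lemma image_open_disk: "e \<in> E \<Longrightarrow> \<Phi> e ` topspace (open_unit_disk (d e)) = e"
  using homeomorphic_imp_surjective_map[OF cell_homeomorphism, of e] Union_upper[of e E]
  by (simp add: Union_cells Int_absorb1)

lemma inj_on_open_disk: "e \<in> E \<Longrightarrow> inj_on (\<Phi> e) (topspace (open_unit_disk (d e)))"
  using homeomorphic_imp_injective_map[OF cell_homeomorphism] .

lemma cell_subset_image: "e \<in> E \<Longrightarrow> e \<subseteq> \<Phi> e ` topspace (unit_disk (d e))"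
  using image_open_disk[of e] by (auto simp: topspace_unit_disk image_Un)

lemma closedin_image_disk:
  assumes "e \<in> E" "closedin (unit_disk (d e)) C"
  shows "closedin X (\<Phi> e ` C)"
  using assms
  by (intro compactin_imp_closedin[OF Hausdorff] image_compactin[OF _ continuous_characteristic_map]
      closedin_compact_space[OF compact_space_unit_disk])

text \<open>The weak topology is phrased with closures of cells. The image of the closed disk is
  closed and contains the cell, hence also its closure, so testing against these images
  suffices.\<close>

lemma closedin_if_cellwise:
  assumes "A \<subseteq> topspace X" "\<And>e. e \<in> E \<Longrightarrow> closedin X (A \<inter> \<Phi> e ` topspace (unit_disk (d e)))"
  shows "closedin X A"
proof -
  have "closedin X (A \<inter> X closure_of e)" if e: "e \<in> E" for e
  proof -
    have "X closure_of e \<subseteq> \<Phi> e ` topspace (unit_disk (d e))"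
      by (intro closure_of_minimal cell_subset_image closedin_image_disk e) simp
    then have "A \<inter> X closure_of e = (A \<inter> \<Phi> e ` topspace (unit_disk (d e))) \<inter> X closure_of e"
      by blast
    then show ?thesis using assms(2)[OF e] by (metis closedin_Int closedin_closure_of)
  qed
  then show ?thesis using weak_topology[OF assms(1)] by simp
qed

text \<open>A closed preimage under \<open>g\<close> meets the image of a closed disk in the image
  of a closed subset of that disk, which is closed by compactness.\<close>

lemma continuous_map_if_cellwise:
  fixes g :: "'a \<Rightarrow> real"
  assumes "\<And>e. e \<in> E \<Longrightarrow> continuous_map (unit_disk (d e)) euclideanreal (g \<circ> \<Phi> e)"
  shows "continuous_map X euclideanreal g"
  unfolding continuous_map_closedin
proof (intro conjI allI impI)
  fix C :: "real set" assume C: "closedin euclideanreal C"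
  show "closedin X {x \<in> topspace X. g x \<in> C}"
  proof (rule closedin_if_cellwise)
    fix e assume e: "e \<in> E"
    have "\<Phi> e ` topspace (unit_disk (d e)) \<subseteq> topspace X"
      using continuous_characteristic_map[OF e] by (rule continuous_map_image_subset_topspace)
    then have "{x \<in> topspace X. g x \<in> C} \<inter> \<Phi> e ` topspace (unit_disk (d e))
        = \<Phi> e ` {z \<in> topspace (unit_disk (d e)). (g \<circ> \<Phi> e) z \<in> C}"
      by auto
    moreover have "closedin (unit_disk (d e)) {z \<in> topspace (unit_disk (d e)). (g \<circ> \<Phi> e) z \<in> C}"
      by (rule closedin_continuous_map_preimage[OF assms[OF e] C])
    ultimately show "closedin X ({x \<in> topspace X. g x \<in> C} \<inter> \<Phi> e ` topspace (unit_disk (d e)))"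
      using closedin_image_disk[OF e] by simp
  qed auto
qed auto

text \<open>During the induction \<open>g\<close> is controlled only on cells of low dimension.
  Continuity on a finite union of closed cells is enough there, since closure finiteness places the
  attaching sphere of the next cell in such a union.\<close>

lemma continuous_map_on_finite_cells:
  fixes g :: "'a \<Rightarrow> real"
  assumes F: "finite F" "F \<subseteq> E"
    and g: "\<And>e. e \<in> F \<Longrightarrow> continuous_map (unit_disk (d e)) euclideanreal (g \<circ> \<Phi> e)"
  shows "continuous_map (subtopology X (\<Union>e\<in>F. \<Phi> e ` topspace (unit_disk (d e)))) euclideanreal g"
    (is "continuous_map (subtopology X ?K) _ g")
  unfolding continuous_map_closedin
proof (intro conjI allI impI)
  fix C :: "real set" assume C: "closedin euclideanreal C"
  have "\<Phi> e ` topspace (unit_disk (d e)) \<subseteq> topspace X" if "e \<in> F" for e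
    using continuous_characteristic_map that F(2)
    by (intro continuous_map_image_subset_topspace) auto
  then have eq: "{x \<in> topspace (subtopology X ?K). g x \<in> C}
      = (\<Union>e\<in>F. \<Phi> e ` {z \<in> topspace (unit_disk (d e)). (g \<circ> \<Phi> e) z \<in> C})"
    by fastforce
  have "closedin X (\<Phi> e ` {z \<in> topspace (unit_disk (d e)). (g \<circ> \<Phi> e) z \<in> C})" if "e \<in> F" for e
    using that F(2) closedin_continuous_map_preimage[OF g[OF that] C]
    by (intro closedin_image_disk) auto
  then have "closedin X (\<Union>e\<in>F. \<Phi> e ` {z \<in> topspace (unit_disk (d e)). (g \<circ> \<Phi> e) z \<in> C})"
    using F(1) by (intro closedin_Union finite_imageI) auto
  with eq show "closedin (subtopology X ?K) {x \<in> topspace (subtopology X ?K). g x \<in> C}"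
    by (intro closedin_subset_topspace) auto
qed auto

lemma boundary_point_cell:
  assumes "e \<in> E" "z \<in> disk_boundary (d e)"
  obtains e' where "e' \<in> E" "d e' < d e" "\<Phi> e z \<in> e'"
proof -
  obtain F where F: "F \<subseteq> E" "\<forall>e'\<in>F. d e' < d e" "\<Phi> e ` disk_boundary (d e) \<subseteq> \<Union>F"
    using closure_finite[OF assms(1)] .
  have "\<Phi> e z \<in> \<Union>F" using F(3) assms(2) by (rule subsetD[OF _ imageI])
  then obtain e' where "e' \<in> F" "\<Phi> e z \<in> e'" by (rule UnionE)
  with F(1,2) show ?thesis by (intro that[of e']) auto
qed

text \<open>Facts known on open cells up to a given dimension thereby transfer to whole closed
  disks, where continuity is tested.\<close>

lemma disk_point_cell:
  assumes "e \<in> E" "z \<in> topspace (unit_disk (d e))"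
  obtains e' where "e' \<in> E" "d e' \<le> d e" "\<Phi> e z \<in> e'"
proof (cases "z \<in> disk_boundary (d e)")
  case True
  obtain e' where "e' \<in> E" "d e' < d e" "\<Phi> e z \<in> e'"
    using boundary_point_cell[OF assms(1) True] .
  then show ?thesis by (intro that[of e']) auto
next
  case False
  with assms(2) have "z \<in> topspace (open_unit_disk (d e))" by (simp add: topspace_unit_disk)
  then have "\<Phi> e z \<in> e" using image_open_disk[OF assms(1)] by blast
  with assms(1) show ?thesis by (intro that[of e]) auto
qed

section \<open>Urysohn functions built by induction on the dimension\<close>

text \<open>The values prescribed on \<open>A\<close>, on \<open>B\<close> and on the attaching sphere are glued on a closed subset
  of the disk and extended by Tietze.\<close>

lemma extend_over_cell:
  fixes g :: "'a \<Rightarrow> real"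
  assumes e: "e \<in> E" and AB: "closedin X A" "closedin X B" "disjnt A B"
    and cont: "\<And>e'. \<lbrakk>e' \<in> E; d e' < d e\<rbrakk> \<Longrightarrow> continuous_map (unit_disk (d e')) euclideanreal (g \<circ> \<Phi> e')"
    and val: "\<And>e' x. \<lbrakk>e' \<in> E; d e' < d e; x \<in> e'\<rbrakk> \<Longrightarrow>
      0 \<le> g x \<and> g x \<le> 1 \<and> (x \<in> A \<longrightarrow> g x = 0) \<and> (x \<in> B \<longrightarrow> g x = 1)"
  obtains h where "continuous_map (unit_disk (d e)) euclideanreal h"
    "\<And>z. z \<in> disk_boundary (d e) \<Longrightarrow> h z = g (\<Phi> e z)"
    "\<And>z. z \<in> topspace (unit_disk (d e)) \<Longrightarrow>
      0 \<le> h z \<and> h z \<le> 1 \<and> (\<Phi> e z \<in> A \<longrightarrow> h z = 0) \<and> (\<Phi> e z \<in> B \<longrightarrow> h z = 1)"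
proof -
  let ?D = "unit_disk (d e)"
  obtain F where F: "F \<subseteq> E" "finite F" "\<forall>e'\<in>F. d e' < d e" "\<Phi> e ` disk_boundary (d e) \<subseteq> \<Union>F"
    using closure_finite[OF e] .
  let ?K = "\<Union>e'\<in>F. \<Phi> e' ` topspace (unit_disk (d e'))"
  note cc = continuous_characteristic_map[OF e]
  define A' where "A' = {z \<in> topspace ?D. \<Phi> e z \<in> A}"
  define B' where "B' = {z \<in> topspace ?D. \<Phi> e z \<in> B}"
  \<comment> \<open>The three closed pieces for the pasting lemma; every index beyond 1 gives
    \<open>B'\<close>.\<close>
  define T where "T i = (if i = (0::nat) then disk_boundary (d e) else if i = 1 then A' else B')" for i
  have cl: "closedin ?D A'" "closedin ?D B'" "closedin ?D (disk_boundary (d e))"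
    using closedin_continuous_map_preimage[OF cc AB(1)] closedin_continuous_map_preimage[OF cc AB(2)]
      closedin_disk_boundary by (simp_all add: A'_def B'_def)
  then have clT: "closedin ?D (T i)" for i by (simp add: T_def)
  have "\<Phi> e ` disk_boundary (d e) \<subseteq> ?K"
  proof -
    have "e' \<subseteq> ?K" if "e' \<in> F" for e'
      by (rule order_trans[OF cell_subset_image UN_upper[OF that]]) (use that F(1) in blast)
    then have "\<Union>F \<subseteq> ?K" by (rule Union_least)
    with F(4) show ?thesis by (rule order_trans)
  qed
  then have "continuous_map (subtopology ?D (disk_boundary (d e))) (subtopology X ?K) (\<Phi> e)"
    unfolding continuous_map_in_subtopology
    using continuous_map_from_subtopology[OF cc] by (auto simp: image_subset_iff)
  moreover have "continuous_map (subtopology X ?K) euclideanreal g"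
    using F cont by (intro continuous_map_on_finite_cells) auto
  ultimately have cont0: "continuous_map (subtopology ?D (disk_boundary (d e))) euclideanreal (g \<circ> \<Phi> e)"
    by (rule continuous_map_compose)
  have bval: "0 \<le> g (\<Phi> e z) \<and> g (\<Phi> e z) \<le> 1 \<and> (\<Phi> e z \<in> A \<longrightarrow> g (\<Phi> e z) = 0) \<and>
      (\<Phi> e z \<in> B \<longrightarrow> g (\<Phi> e z) = 1)" if z: "z \<in> disk_boundary (d e)" for z
  proof -
    obtain e' where "e' \<in> E" "d e' < d e" "\<Phi> e z \<in> e'"
      using boundary_point_cell[OF e z] .
    then show ?thesis by (rule val)
  qed
  define S where "S = disk_boundary (d e) \<union> A' \<union> B'"
  have clS: "closedin ?D S" unfolding S_def by (intro closedin_Un cl)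
  have ST: "S = (\<Union>i\<in>{0,1,2}. T i)" by (auto simp: S_def T_def)
  have TS: "T i \<subseteq> S" for i by (auto simp: T_def S_def)
  \<comment> \<open>The boundary value takes precedence. By \<open>bval\<close> and the disjointness
    of \<open>A\<close> and \<open>B\<close> the three prescriptions agree on overlaps, so
    \<open>v\<close> is the right function on each piece.\<close>
  define v where "v z = (if z \<in> disk_boundary (d e) then g (\<Phi> e z) else if z \<in> A' then 0 else 1)" for z
  have vA: "v z = 0" if "z \<in> A'" for z
    using that bval[of z] by (cases "z \<in> disk_boundary (d e)") (simp_all add: v_def A'_def)
  have vB: "v z = 1" if "z \<in> B'" for z
  proof -
    have "z \<notin> A'" using that AB(3) by (auto simp: A'_def B'_def disjnt_iff)
    then show ?thesis
      using that bval[of z] by (cases "z \<in> disk_boundary (d e)") (simp_all add: v_def B'_def)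
  qed
  have contT: "continuous_map (subtopology ?D (T i)) euclideanreal v" for i
  proof -
    consider "i = 0" | "i = 1" | "i \<noteq> 0" "i \<noteq> 1" by blast
    then show ?thesis
    proof cases
      case 1
      show ?thesis by (rule continuous_map_eq[of _ _ "g \<circ> \<Phi> e"]) (use cont0 1 in \<open>simp_all add: T_def v_def\<close>)
    next
      case 2
      show ?thesis by (rule continuous_map_eq[of _ _ "\<lambda>_. 0"]) (use 2 vA in \<open>simp_all add: T_def\<close>)
    next
      case 3
      show ?thesis by (rule continuous_map_eq[of _ _ "\<lambda>_. 1"]) (use 3 vB in \<open>simp_all add: T_def\<close>)
    qed
  qed
  have contv: "continuous_map (subtopology ?D S) euclideanreal v"
  proof (rule pasting_lemma_closed[of "{0,1,2}" "subtopology ?D S" T euclideanreal "\<lambda>_. v"])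
    show "closedin (subtopology ?D S) (T i)" for i
      using clT TS by (rule closedin_subset_topspace)
    show "continuous_map (subtopology (subtopology ?D S) (T i)) euclideanreal v" for i
      using contT TS[of i] by (simp add: subtopology_subtopology Int_absorb1)
    show "\<exists>j. j \<in> {0,1,2} \<and> z \<in> T j \<and> v z = v z" if "z \<in> topspace (subtopology ?D S)" for z
      using that ST by auto
  qed auto
  have "v ` S \<subseteq> {0..1}"
    using bval by (auto simp: v_def)
  then obtain h where h: "continuous_map ?D euclideanreal h" "\<And>z. z \<in> S \<Longrightarrow> h z = v z"
      "h ` topspace ?D \<subseteq> {0..1}"
    using Tietze_extension_closed_real_interval[OF normal_space_unit_disk clS contv, of 0 1] by auto
  show thesis
  proof
    show "continuous_map ?D euclideanreal h" by fact
    show "h z = g (\<Phi> e z)" if "z \<in> disk_boundary (d e)" for z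
      using h(2)[of z] that by (simp add: S_def v_def)
    show "0 \<le> h z \<and> h z \<le> 1 \<and> (\<Phi> e z \<in> A \<longrightarrow> h z = 0) \<and> (\<Phi> e z \<in> B \<longrightarrow> h z = 1)"
      if "z \<in> topspace ?D" for z
    proof (intro conjI impI)
      have "h z \<in> {0..1}" using h(3) that by blast
      then show "0 \<le> h z" "h z \<le> 1" by auto
      show "h z = 0" if "\<Phi> e z \<in> A"
      proof -
        have "z \<in> A'" using that \<open>z \<in> topspace ?D\<close> by (simp add: A'_def)
        then show ?thesis using vA h(2)[of z] by (simp add: S_def)
      qed
      show "h z = 1" if "\<Phi> e z \<in> B"
      proof -
        have "z \<in> B'" using that \<open>z \<in> topspace ?D\<close> by (simp add: B'_def)
        then show ?thesis using vB h(2)[of z] by (simp add: S_def)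
      qed
    qed
  qed
qed

text \<open>A Urysohn function on the cells of dimension below \<open>n\<close>, carried by a total
  function with arbitrary values elsewhere. The strict bound makes stage 0 vacuous. Continuity is
  stated on closed disks because it is tested there on all of \<open>X\<close>.\<close>

definition Urysohn_upto :: "'a set \<Rightarrow> 'a set \<Rightarrow> nat \<Rightarrow> ('a \<Rightarrow> real) \<Rightarrow> bool" where
  "Urysohn_upto A B n g \<longleftrightarrow> (\<forall>e\<in>E. d e < n \<longrightarrow>
     continuous_map (unit_disk (d e)) euclideanreal (g \<circ> \<Phi> e) \<and>
     (\<forall>x\<in>e. 0 \<le> g x \<and> g x \<le> 1 \<and> (x \<in> A \<longrightarrow> g x = 0) \<and> (x \<in> B \<longrightarrow> g x = 1)))"

text \<open>The extensions over the \<open>n\<close>-cells can be chosen independently: open cells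
  are disjoint, and each extension matches \<open>g\<close> on its attaching sphere. Leaving the
  lower cells untouched is what makes the stages stabilize.\<close>

lemma Urysohn_upto_Suc:
  assumes AB: "closedin X A" "closedin X B" "disjnt A B" and g: "Urysohn_upto A B n g"
  shows "\<exists>g'. Urysohn_upto A B (Suc n) g' \<and> (\<forall>e\<in>E. d e < n \<longrightarrow> (\<forall>x\<in>e. g' x = g x))"
proof -
  define P where "P e h \<longleftrightarrow> continuous_map (unit_disk (d e)) euclideanreal h \<and>
      (\<forall>z \<in> disk_boundary (d e). h z = g (\<Phi> e z)) \<and>
      (\<forall>z \<in> topspace (unit_disk (d e)).
        0 \<le> h z \<and> h z \<le> 1 \<and> (\<Phi> e z \<in> A \<longrightarrow> h z = 0) \<and> (\<Phi> e z \<in> B \<longrightarrow> h z = 1))" for e h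
  \<comment> \<open>The premise sits inside the existential so that \<open>choice\<close> yields one
    total function.\<close>
  have "\<forall>e. \<exists>h. e \<in> E \<and> d e = n \<longrightarrow> P e h"
  proof
    fix e
    show "\<exists>h. e \<in> E \<and> d e = n \<longrightarrow> P e h"
    proof (cases "e \<in> E \<and> d e = n")
      case True
      have "\<exists>h. P e h"
        by (rule extend_over_cell[OF conjunct1[OF True] AB, of g])
          (use g True in \<open>auto simp: P_def Urysohn_upto_def\<close>)
      then show ?thesis by blast
    qed auto
  qed
  from choice[OF this] obtain h where P: "\<forall>e. e \<in> E \<and> d e = n \<longrightarrow> P e (h e)" ..
  have h: "continuous_map (unit_disk (d e)) euclideanreal (h e)"
      "z \<in> disk_boundary (d e) \<Longrightarrow> h e z = g (\<Phi> e z)"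
      "z \<in> topspace (unit_disk (d e)) \<Longrightarrow>
        0 \<le> h e z \<and> h e z \<le> 1 \<and> (\<Phi> e z \<in> A \<longrightarrow> h e z = 0) \<and> (\<Phi> e z \<in> B \<longrightarrow> h e z = 1)"
    if "e \<in> E" "d e = n" for e z
  proof -
    have "P e (h e)" using P that by simp
    then show "continuous_map (unit_disk (d e)) euclideanreal (h e)"
      "z \<in> disk_boundary (d e) \<Longrightarrow> h e z = g (\<Phi> e z)"
      "z \<in> topspace (unit_disk (d e)) \<Longrightarrow>
        0 \<le> h e z \<and> h e z \<le> 1 \<and> (\<Phi> e z \<in> A \<longrightarrow> h e z = 0) \<and> (\<Phi> e z \<in> B \<longrightarrow> h e z = 1)"
      by (simp_all add: P_def)
  qed
  define cell where "cell x = (THE e. e \<in> E \<and> x \<in> e)" for x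
  have cell: "cell x = e" if "e \<in> E" "x \<in> e" for e x
    unfolding cell_def by (rule the_equality) (use that cell_unique in auto)
  \<comment> \<open>A point of an open \<open>n\<close>-cell is pulled back through the
    characteristic map, which is injective on the open disk; all other points keep the value of
    \<open>g\<close>.\<close>
  define g' where "g' x = (if d (cell x) = n
      then h (cell x) (inv_into (topspace (open_unit_disk n)) (\<Phi> (cell x)) x) else g x)" for x
  have old: "g' x = g x" if "e \<in> E" "x \<in> e" "d e < n" for e x
    using cell[OF that(1,2)] that(3) by (simp add: g'_def)
  \<comment> \<open>On the sphere the characteristic map may fail to be injective, but its image
    lies in lower cells, where \<open>g'\<close> is \<open>g\<close> and \<open>h e\<close> was
    matched to it.\<close>
  have new: "g' (\<Phi> e z) = h e z" if e: "e \<in> E" "d e = n" and z: "z \<in> topspace (unit_disk (d e))" for e z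
  proof (cases "z \<in> disk_boundary (d e)")
    case True
    obtain e' where "e' \<in> E" "d e' < d e" "\<Phi> e z \<in> e'"
      using boundary_point_cell[OF e(1) True] .
    then show ?thesis using old h(2)[OF e True] e(2) by simp
  next
    case False
    then have zo: "z \<in> topspace (open_unit_disk (d e))" using z topspace_unit_disk by blast
    then have "\<Phi> e z \<in> e" using image_open_disk[OF e(1)] by blast
    then have "cell (\<Phi> e z) = e" using cell e(1) by blast
    then show ?thesis using inv_into_f_f[OF inj_on_open_disk[OF e(1)] zo] e(2) by (simp add: g'_def)
  qed
  have "Urysohn_upto A B (Suc n) g'"
    unfolding Urysohn_upto_def
  proof (intro ballI impI)
    fix e assume e: "e \<in> E" "d e < Suc n"
    show "continuous_map (unit_disk (d e)) euclideanreal (g' \<circ> \<Phi> e) \<and>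
      (\<forall>x\<in>e. 0 \<le> g' x \<and> g' x \<le> 1 \<and> (x \<in> A \<longrightarrow> g' x = 0) \<and> (x \<in> B \<longrightarrow> g' x = 1))"
    proof (cases "d e = n")
      case True
      have "continuous_map (unit_disk (d e)) euclideanreal (g' \<circ> \<Phi> e)"
        by (rule continuous_map_eq[OF h(1)[OF e(1) True]]) (simp add: new[OF e(1) True])
      moreover have "0 \<le> g' x \<and> g' x \<le> 1 \<and> (x \<in> A \<longrightarrow> g' x = 0) \<and> (x \<in> B \<longrightarrow> g' x = 1)" if "x \<in> e" for x
        using cell_subset_image[OF e(1)] that new[OF e(1) True] h(3)[OF e(1) True] by auto
      ultimately show ?thesis by blast
    next
      case False
      then have de: "d e < n" using e(2) by simp
      \<comment> \<open>The closed cell meets only open cells of dimension at most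
        \<open>d e\<close>, all below \<open>n\<close>.\<close>
      have "g' (\<Phi> e z) = g (\<Phi> e z)" if z: "z \<in> topspace (unit_disk (d e))" for z
      proof -
        obtain e' where "e' \<in> E" "d e' \<le> d e" "\<Phi> e z \<in> e'" using disk_point_cell[OF e(1) z] .
        then show ?thesis using de by (intro old[of e']) auto
      qed
      then have "continuous_map (unit_disk (d e)) euclideanreal (g' \<circ> \<Phi> e)"
        using g e(1) de by (auto simp: Urysohn_upto_def intro: continuous_map_eq)
      then show ?thesis using g e(1) de old[OF e(1)] by (auto simp: Urysohn_upto_def)
    qed
  qed
  then show ?thesis using old by blast
qed

text \<open>Dependent choice gives compatible stages. On a cell \<open>e\<close> nothing changes
  from stage \<open>Suc (d e)\<close> on, so a pointwise limit exists, and on each closed disk it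
  coincides with a single stage.\<close>

lemma normal_space: "normal_space X"
  unfolding normal_space_iff_Urysohn_alt
proof (intro allI impI, elim conjE)
  fix A B assume AB: "closedin X A" "closedin X B" "disjnt A B"
  have "\<exists>g. \<forall>n. Urysohn_upto A B n (g n) \<and> (\<forall>e\<in>E. d e < n \<longrightarrow> (\<forall>x\<in>e. g (Suc n) x = g n x))"
    by (rule dependent_nat_choice[of "Urysohn_upto A B"
          "\<lambda>n g g'. \<forall>e\<in>E. d e < n \<longrightarrow> (\<forall>x\<in>e. g' x = g x)"])
      (simp add: Urysohn_upto_def, rule Urysohn_upto_Suc[OF AB])
  then obtain G where G': "\<forall>n. Urysohn_upto A B n (G n) \<and>
      (\<forall>e\<in>E. d e < n \<longrightarrow> (\<forall>x\<in>e. G (Suc n) x = G n x))" ..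
  then have G: "Urysohn_upto A B n (G n)"
      "\<lbrakk>e \<in> E; d e < n; x \<in> e\<rbrakk> \<Longrightarrow> G (Suc n) x = G n x" for n e x
    by simp_all
  have stable: "G n x = G (Suc (d e)) x" if "e \<in> E" "x \<in> e" "d e < n" for e x n
  proof -
    have "Suc (d e) \<le> n" using that(3) by simp
    then show ?thesis
      by (induction rule: dec_induct) (simp_all add: G(2)[OF that(1) _ that(2)])
  qed
  define cell where "cell x = (THE e. e \<in> E \<and> x \<in> e)" for x
  have cell: "cell x = e" if "e \<in> E" "x \<in> e" for e x
    unfolding cell_def by (rule the_equality) (use that cell_unique in auto)
  define g where "g x = G (Suc (d (cell x))) x" for x
  have g: "g x = G n x" if "e \<in> E" "x \<in> e" "d e < n" for e x n
    using stable[OF that] cell[OF that(1,2)] by (simp add: g_def)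
  have "continuous_map X euclideanreal g"
  proof (rule continuous_map_if_cellwise)
    fix e assume e: "e \<in> E"
    have "g (\<Phi> e z) = G (Suc (d e)) (\<Phi> e z)" if z: "z \<in> topspace (unit_disk (d e))" for z
    proof -
      obtain e' where "e' \<in> E" "d e' \<le> d e" "\<Phi> e z \<in> e'" using disk_point_cell[OF e z] .
      then show ?thesis by (intro g[of e']) auto
    qed
    then show "continuous_map (unit_disk (d e)) euclideanreal (g \<circ> \<Phi> e)"
      using G(1)[of "Suc (d e)"] e by (auto simp: Urysohn_upto_def intro: continuous_map_eq)
  qed
  moreover have "(x \<in> A \<longrightarrow> g x = 0) \<and> (x \<in> B \<longrightarrow> g x = 1)" if x: "x \<in> topspace X" for x
  proof -
    obtain e where e: "e \<in> E" "x \<in> e" using x Union_cells by blast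
    then show ?thesis using G(1)[of "Suc (d e)"] g[OF e lessI] by (auto simp: Urysohn_upto_def)
  qed
  then have "g ` A \<subseteq> {0}" "g ` B \<subseteq> {1}" using AB(1,2)[THEN closedin_subset] by auto
  ultimately show "\<exists>f. continuous_map X euclideanreal f \<and> f ` A \<subseteq> {0} \<and> f ` B \<subseteq> {1}" by blast
qed

end

lemma CW_space_imp_normal_space: "CW_space X \<Longrightarrow> normal_space X"
  unfolding CW_space_def using CW.normal_space CW.intro by blast

section \<open>A family of disjoint refinements of an open cover\<close>

text \<open>The sets \<open>U i\<close> are replaced one at a time by \<open>{\<phi> i > 1}\<close>,
  each by a Urysohn function that keeps the whole family a cover. The range \<open>{0..2}\<close>
  leaves room for the threshold 1, which the total sum of the bumps must later exceed.\<close>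

lemma normal_space_bump_functions:
  assumes X: "normal_space X" and U: "\<And>i. i \<le> k \<Longrightarrow> openin X (U i)"
    and cover: "(\<Union>i\<le>k. U i) = topspace X"
  obtains \<phi> :: "nat \<Rightarrow> 'a \<Rightarrow> real" where
    "\<And>i. i \<le> k \<Longrightarrow> continuous_map X euclideanreal (\<phi> i)"
    "\<And>i x. \<lbrakk>i \<le> k; x \<in> topspace X\<rbrakk> \<Longrightarrow> 0 \<le> \<phi> i x"
    "\<And>i x. \<lbrakk>i \<le> k; x \<in> topspace X; x \<notin> U i\<rbrakk> \<Longrightarrow> \<phi> i x = 0"
    "\<And>x. x \<in> topspace X \<Longrightarrow> \<exists>i\<le>k. \<phi> i x > 1"
proof -
  define bump where "bump i h \<longleftrightarrow> continuous_map X (top_of_set {0..2::real}) h \<and>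
      (\<forall>x\<in>topspace X - U i. h x = 0)" for i h
  have "\<exists>\<phi>. (\<forall>i<j. bump i (\<phi> i)) \<and>
      topspace X \<subseteq> (\<Union>i<j. {x \<in> topspace X. \<phi> i x > 1}) \<union> (\<Union>i\<in>{j..k}. U i)"
    if "j \<le> Suc k" for j
    using that
  proof (induction j)
    case 0
    have "topspace X \<subseteq> (\<Union>i\<in>{0..k}. U i)" using cover by (simp add: atLeast0AtMost)
    then show ?case by simp
  next
    case (Suc j)
    then obtain \<phi> where \<phi>: "\<forall>i<j. bump i (\<phi> i)"
        "topspace X \<subseteq> (\<Union>i<j. {x \<in> topspace X. \<phi> i x > 1}) \<union> (\<Union>i\<in>{j..k}. U i)"
      by auto
    let ?V = "(\<Union>i<j. {x \<in> topspace X. \<phi> i x > 1}) \<union> (\<Union>i\<in>{Suc j..k}. U i)"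
    have "openin X {x \<in> topspace X. \<phi> i x \<in> {1<..}}" if "i < j" for i
      by (rule openin_continuous_map_preimage[of _ euclideanreal])
        (use \<phi>(1) that in \<open>auto simp: bump_def continuous_map_in_subtopology\<close>)
    then have "openin X ?V"
      using U by (intro openin_Un openin_Union) auto
    then have "closedin X (topspace X - ?V)" by blast
    moreover have "closedin X (topspace X - U j)" using U[of j] Suc.prems by auto
    \<comment> \<open>A point outside both \<open>U j\<close> and \<open>?V\<close> would escape the
      cover of the previous stage.\<close>
    moreover have "disjnt (topspace X - U j) (topspace X - ?V)"
    proof -
      have "{j..k} = insert j {Suc j..k}" using Suc.prems by auto
      with \<phi>(2) show ?thesis by (auto simp: disjnt_iff)
    qed
    ultimately obtain h where h: "continuous_map X (top_of_set {0..2::real}) h"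
        "h ` (topspace X - U j) \<subseteq> {0}" "h ` (topspace X - ?V) \<subseteq> {2}"
      using Urysohn_lemma[OF X, of "topspace X - U j" "topspace X - ?V" 0 2] by auto
    let ?\<phi> = "\<phi>(j := h)"
    have "\<forall>i<Suc j. bump i (?\<phi> i)"
      using \<phi>(1) h(1,2) by (auto simp: less_Suc_eq bump_def)
    moreover have "topspace X \<subseteq> (\<Union>i<Suc j. {x \<in> topspace X. ?\<phi> i x > 1}) \<union> (\<Union>i\<in>{Suc j..k}. U i)"
    proof
      fix x assume x: "x \<in> topspace X"
      show "x \<in> (\<Union>i<Suc j. {x \<in> topspace X. ?\<phi> i x > 1}) \<union> (\<Union>i\<in>{Suc j..k}. U i)"
      proof (cases "x \<in> ?V")
        case True
        then show ?thesis by (auto simp: lessThan_Suc)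
      next
        case False
        then have "h x \<in> {2}" using h(3) x by (intro subsetD[OF h(3)] imageI) blast
        then have "?\<phi> j x > 1" by simp
        then show ?thesis using x by blast
      qed
    qed
    ultimately show ?case by blast
  qed
  from this[of "Suc k"] obtain \<phi> where \<phi>: "\<forall>i<Suc k. bump i (\<phi> i)"
      "topspace X \<subseteq> (\<Union>i<Suc k. {x \<in> topspace X. \<phi> i x > 1})"
    by auto
  show thesis
  proof
    show "continuous_map X euclideanreal (\<phi> i)" if "i \<le> k" for i
      using \<phi>(1) that by (auto simp: bump_def continuous_map_in_subtopology)
    show "0 \<le> \<phi> i x" if "i \<le> k" "x \<in> topspace X" for i x
    proof -
      have "\<phi> i \<in> topspace X \<rightarrow> {0..2}"
        using \<phi>(1) that(1) by (auto simp: bump_def continuous_map_in_subtopology)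
      with that(2) show ?thesis by auto
    qed
    show "\<phi> i x = 0" if "i \<le> k" "x \<in> topspace X" "x \<notin> U i" for i x
      using \<phi>(1) that by (auto simp: bump_def)
    show "\<exists>i\<le>k. \<phi> i x > 1" if "x \<in> topspace X" for x
    proof -
      have "x \<in> (\<Union>i<Suc k. {x \<in> topspace X. \<phi> i x > 1})" using \<phi>(2) that by (rule subsetD)
      then show ?thesis by (auto simp: less_Suc_eq_le)
    qed
  qed
qed

text \<open>The \<open>t\<close>-th refinement consists of the sets \<open>{x. s\<^sub>i x < t < s\<^sub>i\<^sub>+\<^sub>1 x}\<close>, where \<open>s\<^sub>i\<close> is the sum of
  the first \<open>i\<close> bump functions. It misses \<open>x\<close> only if \<open>t\<close> is one of the values \<open>s\<^sub>1 x, \<dots>, s\<^sub>k x\<close>.\<close>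

lemma normal_space_disjoint_refinements:
  assumes X: "normal_space X" and U: "\<And>i. i \<le> k \<Longrightarrow> openin X (U i)"
    and cover: "(\<Union>i\<le>k. U i) = topspace X"
  obtains G :: "nat \<Rightarrow> nat \<Rightarrow> 'a set" where
    "\<And>j i. i \<le> k \<Longrightarrow> openin X (G j i)"
    "\<And>j i. i \<le> k \<Longrightarrow> G j i \<subseteq> U i"
    "\<And>j. disjoint_family_on (G j) {..k}"
    "\<And>x. x \<in> topspace X \<Longrightarrow>
      finite {j. x \<notin> (\<Union>i\<le>k. G j i)} \<and> card {j. x \<notin> (\<Union>i\<le>k. G j i)} \<le> k"
proof -
  obtain \<phi> :: "nat \<Rightarrow> 'a \<Rightarrow> real" where
    \<phi>: "\<And>i. i \<le> k \<Longrightarrow> continuous_map X euclideanreal (\<phi> i)"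
      "\<And>i x. \<lbrakk>i \<le> k; x \<in> topspace X\<rbrakk> \<Longrightarrow> 0 \<le> \<phi> i x"
      "\<And>i x. \<lbrakk>i \<le> k; x \<in> topspace X; x \<notin> U i\<rbrakk> \<Longrightarrow> \<phi> i x = 0"
      "\<And>x. x \<in> topspace X \<Longrightarrow> \<exists>i\<le>k. \<phi> i x > 1"
    using normal_space_bump_functions[OF X U cover] by auto
  define s where "s i x = (\<Sum>l<i. \<phi> l x)" for i x
  \<comment> \<open>Infinitely many distinct thresholds: positive, to lie above
    \<open>s 0 = 0\<close>, and at most 1, to lie below the last sum.\<close>
  define \<tau> where "\<tau> j = 1 / (real j + 1)" for j
  have \<tau>: "0 < \<tau> j" "\<tau> j \<le> 1" for j by (simp_all add: \<tau>_def)
  have inj_\<tau>: "inj \<tau>" by (auto simp: \<tau>_def inj_on_def)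
  define G where "G j i = {x \<in> topspace X. s i x < \<tau> j \<and> \<tau> j < s (Suc i) x}" for j i
  have cont_s: "continuous_map X euclideanreal (s i)" if "i \<le> Suc k" for i
    unfolding s_def using \<phi>(1) that by (intro continuous_map_sum) auto
  have mono_s: "s i x \<le> s j x" if "i \<le> j" "j \<le> Suc k" "x \<in> topspace X" for i j x
    unfolding s_def using \<phi>(2) that by (intro sum_mono2) auto
  have last_s: "1 < s (Suc k) x" if x: "x \<in> topspace X" for x
  proof -
    obtain i where i: "i \<le> k" "\<phi> i x > 1" using \<phi>(4)[OF x] by blast
    have "\<phi> i x \<le> s (Suc k) x"
      unfolding s_def using i(1) \<phi>(2) x by (intro member_le_sum) auto
    with i show ?thesis by simp
  qed
  show thesis
  proof
    show "openin X (G j i)" if "i \<le> k" for j i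
    proof -
      have "openin X {x \<in> topspace X. s i x \<in> {..<\<tau> j}}"
        "openin X {x \<in> topspace X. s (Suc i) x \<in> {\<tau> j<..}}"
        using that by (auto intro!: openin_continuous_map_preimage[of _ euclideanreal] cont_s simp del: greaterThan_iff lessThan_iff)
      then have "openin X ({x \<in> topspace X. s i x \<in> {..<\<tau> j}} \<inter> {x \<in> topspace X. s (Suc i) x \<in> {\<tau> j<..}})"
        by (rule openin_Int)
      also have "\<dots> = G j i" by (auto simp: G_def)
      finally show ?thesis .
    qed
    \<comment> \<open>Off \<open>U i\<close> the bump \<open>\<phi> i\<close> vanishes, so two
      consecutive sums coincide and leave no room for the threshold.\<close>
    show "G j i \<subseteq> U i" if "i \<le> k" for j i
      using \<phi>(3)[OF that] by (fastforce simp: G_def s_def)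
    have "G j i \<inter> G j l = {}" if "i < l" "l \<le> k" for j i l
      using mono_s[of "Suc i" l] that by (fastforce simp: G_def)
    then show "disjoint_family_on (G j) {..k}" for j
      unfolding disjoint_family_on_def by (metis atMost_iff inf_commute linorder_neqE_nat)
    show "finite {j. x \<notin> (\<Union>i\<le>k. G j i)} \<and> card {j. x \<notin> (\<Union>i\<le>k. G j i)} \<le> k"
      (is "finite ?J \<and> _") if x: "x \<in> topspace X" for x
    proof -
      let ?S = "(\<lambda>i. s (Suc i) x) ` {..<k}"
      have "\<tau> ` ?J \<subseteq> ?S"
      proof clarify
        fix j assume j: "x \<notin> (\<Union>i\<le>k. G j i)"
        \<comment> \<open>The first sum beyond the threshold. Its predecessor \<open>s l\<close>
          does not exceed \<open>\<tau> j\<close>, and lying strictly below would put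
          \<open>x\<close> in \<open>G j l\<close>; hence equality.\<close>
        define i where "i = (LEAST i. \<tau> j < s i x)"
        have last: "\<tau> j < s (Suc k) x" using last_s[OF x] \<tau>(2)[of j] by simp
        then have i: "\<tau> j < s i x" unfolding i_def by (rule LeastI)
        have ik: "i \<le> Suc k" unfolding i_def using last by (rule Least_le)
        have "i \<noteq> 0"
        proof
          assume "i = 0"
          with i \<tau>(1)[of j] show False by (simp add: s_def)
        qed
        then obtain l where l: "i = Suc l" by (cases i) auto
        have "\<not> \<tau> j < s l x"
          using l not_less_Least[of l "\<lambda>i. \<tau> j < s i x"] by (simp add: i_def)
        moreover have "\<not> s l x < \<tau> j" using j i ik l x by (auto simp: G_def)
        ultimately have eq: "\<tau> j = s l x" by simp
        \<comment> \<open>Excluding \<open>s 0\<close> leaves \<open>k\<close> rather than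
          \<open>k + 1\<close> possible values; the bound \<open>n * k\<close> for powers depends on
          this.\<close>
        have "l \<noteq> 0"
        proof
          assume "l = 0"
          with eq \<tau>(1)[of j] show False by (simp add: s_def)
        qed
        then obtain m where "l = Suc m" by (cases l) auto
        then show "\<tau> j \<in> ?S" using eq ik l by auto
      qed
      moreover have "inj_on \<tau> ?J" using inj_\<tau> by (rule inj_on_subset) simp
      moreover have "finite ?S" "card ?S \<le> k" using card_image_le[of "{..<k}"] by auto
      ultimately show ?thesis by (meson card_inj_on_le inj_on_finite le_trans)
    qed
  qed
qed

section \<open>Null-homotopic maps\<close>

text \<open>Null-homotopies on different pieces may end at different points; path-connectedness of
  \<open>Q\<close> moves them all to one prescribed \<open>y\<close>. The guard on \<open>y\<close>
  covers an empty \<open>P\<close>, where \<open>Q\<close> may be empty too.\<close>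

lemma null_homotopic_imp_homotopic_const:
  assumes h: "null_homotopic P Q h" and Q: "path_connected_space Q"
    and y: "P \<noteq> trivial_topology \<Longrightarrow> y \<in> topspace Q"
  shows "homotopic_with (\<lambda>_. True) P Q h (\<lambda>_. y)"
proof (cases "P = trivial_topology")
  case True
  then show ?thesis by (simp add: homotopic_on_empty)
next
  case False
  obtain c where c: "homotopic_with (\<lambda>_. True) P Q h (\<lambda>_. c)"
    using h by (auto simp: null_homotopic_def)
  obtain p where p: "p \<in> topspace P" using False by fastforce
  have "c \<in> topspace Q"
    using homotopic_with_imp_continuous_maps[OF c] p False by (auto simp: continuous_map_const)
  then have "path_component_of Q c y"
    using Q y[OF False] by (simp add: path_connected_space_iff_path_component)
  then have "homotopic_with (\<lambda>_. True) P Q (\<lambda>_. c) (\<lambda>_. y)"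
    by (simp add: homotopic_constant_maps)
  with c show ?thesis by (rule homotopic_with_trans)
qed

text \<open>Over disjoint open sets the local homotopies paste with no compatibility to check; the
  shared endpoint \<open>y\<close> keeps the final map constant.\<close>

lemma homotopic_const_disjoint_Union:
  assumes G: "\<And>i. i \<in> I \<Longrightarrow> openin X (G i)" "disjoint_family_on G I"
    and hom: "\<And>i. i \<in> I \<Longrightarrow> homotopic_with (\<lambda>_. True) (subtopology X (G i)) Y f (\<lambda>_. y)"
  shows "homotopic_with (\<lambda>_. True) (subtopology X (\<Union>i\<in>I. G i)) Y f (\<lambda>_. y)"
proof -
  let ?T = "top_of_set {0..1::real}"
  let ?Z = "subtopology X (\<Union>i\<in>I. G i)"
  have "\<forall>i\<in>I. \<exists>h. continuous_map (prod_topology ?T (subtopology X (G i))) Y h \<and>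
      (\<forall>x. h (0, x) = f x) \<and> (\<forall>x. h (1, x) = y)"
    using hom unfolding homotopic_with_def by blast
  from bchoice[OF this] obtain h where
    h: "\<And>i. i \<in> I \<Longrightarrow> continuous_map (prod_topology ?T (subtopology X (G i))) Y (h i)"
      "\<And>i x. i \<in> I \<Longrightarrow> h i (0, x) = f x" "\<And>i x. i \<in> I \<Longrightarrow> h i (1, x) = y"
    by auto
  obtain H where H: "continuous_map (prod_topology ?T ?Z) Y H"
    "\<And>z i. \<lbrakk>i \<in> I; z \<in> topspace (prod_topology ?T ?Z) \<inter> ({0..1} \<times> G i)\<rbrakk> \<Longrightarrow> H z = h i z"
  proof (rule pasting_lemma_exists[where X = "prod_topology ?T ?Z" and I = I and T = "\<lambda>i. {0..1} \<times> G i" and Y = Y and f = h])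
    show "topspace (prod_topology ?T ?Z) \<subseteq> (\<Union>i\<in>I. {0..1} \<times> G i)" by auto
    show "openin (prod_topology ?T ?Z) ({0..1} \<times> G i)" if "i \<in> I" for i
    proof -
      have "openin ?Z (G i)" using G(1)[OF that] that unfolding openin_subtopology by blast
      then show ?thesis by (simp add: openin_prod_Times_iff openin_subtopology_refl)
    qed
    show "continuous_map (subtopology (prod_topology ?T ?Z) ({0..1} \<times> G i)) Y (h i)" if "i \<in> I" for i
    proof -
      have "(\<Union>i\<in>I. G i) \<inter> G i = G i" using that by blast
      then show ?thesis
        using h(1)[OF that] by (simp add: subtopology_Times subtopology_subtopology)
    qed
    show "h i z = h j z" if "i \<in> I" "j \<in> I"
      "z \<in> topspace (prod_topology ?T ?Z) \<inter> ({0..1} \<times> G i) \<inter> ({0..1} \<times> G j)" for i j z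
      using that G(2) by (cases "i = j") (auto simp: disjoint_family_on_def)
  qed auto
  have "H (0, x) = f x \<and> H (1, x) = y" if x: "x \<in> topspace ?Z" for x
  proof -
    obtain i where i: "i \<in> I" "x \<in> G i" using x by auto
    then show ?thesis using H(2)[OF i(1), of "(0, x)"] H(2)[OF i(1), of "(1, x)"] h(2,3)[OF i(1)] x
      by auto
  qed
  with H(1) show ?thesis by (subst homotopic_with) auto
qed

text \<open>The given homotopy runs in all coordinates simultaneously and ends at the constant tuple
  of \<open>y\<close>.\<close>

lemma null_homotopic_power_map:
  assumes "homotopic_with (\<lambda>_. True) (subtopology X U) Y f (\<lambda>_. y)"
  shows "null_homotopic (subtopology (power_space n X) (PiE {..<n} (\<lambda>_. U))) (power_space n Y) (power_map n f)"
proof -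
  let ?T = "top_of_set {0..1::real}"
  obtain h where h: "continuous_map (prod_topology ?T (subtopology X U)) Y h"
      "\<And>x. h (0, x) = f x" "\<And>x. h (1, x) = y"
    using assms unfolding homotopic_with_def by blast
  let ?P = "product_topology (\<lambda>_. subtopology X U) {..<n}"
  define H where "H z = (\<lambda>i\<in>{..<n}. h (fst z, snd z i))" for z :: "real \<times> (nat \<Rightarrow> 'a)"
  have "continuous_map (prod_topology ?T ?P) (power_space n Y) H"
    unfolding power_space_def continuous_map_componentwise
  proof (intro conjI ballI)
    show "H ` topspace (prod_topology ?T ?P) \<subseteq> extensional {..<n}" by (auto simp: H_def)
    fix i assume i: "i \<in> {..<n}"
    have "continuous_map (prod_topology ?T ?P) (subtopology X U) ((\<lambda>x. x i) \<circ> snd)"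
      by (rule continuous_map_compose[OF continuous_map_snd continuous_map_product_projection[OF i]])
    then have "continuous_map (prod_topology ?T ?P) (prod_topology ?T (subtopology X U)) (\<lambda>z. (fst z, snd z i))"
      by (intro continuous_map_pairedI continuous_map_fst) (simp add: o_def)
    from continuous_map_compose[OF this h(1)]
    show "continuous_map (prod_topology ?T ?P) Y (\<lambda>z. H z i)"
      using i by (simp add: H_def o_def)
  qed
  moreover have "H (0, x) = power_map n f x" "H (1, x) = (\<lambda>i\<in>{..<n}. y)" for x
    by (simp_all add: H_def power_map_def h(2,3))
  ultimately have "homotopic_with (\<lambda>_. True) ?P (power_space n Y) (power_map n f) (\<lambda>_. \<lambda>i\<in>{..<n}. y)"
    unfolding homotopic_with_def by blast
  then show ?thesis
    unfolding null_homotopic_def power_space_def subtopology_product_topology by blast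
qed

lemma topspace_power_space: "topspace (power_space n X) = PiE {..<n} (\<lambda>_. topspace X)"
  by (simp add: power_space_def)

lemma path_connected_power_space: "path_connected_space X \<Longrightarrow> path_connected_space (power_space n X)"
  by (simp add: power_space_def path_connected_space_product_topology)

section \<open>The category of a power map\<close>

lemma LS_cat_le:
  assumes "\<And>i. i \<le> k \<Longrightarrow> openin P (U i)" "\<And>i. i \<le> k \<Longrightarrow> null_homotopic (subtopology P (U i)) Q h"
    and "(\<Union>i\<le>k. U i) = topspace P"
  shows "LS_cat P Q h \<le> enat k"
  unfolding LS_cat_def using assms by (intro Inf_lower) blast

text \<open>A finite value rules out an empty set of candidates, whose infimum is infinite;
  well-ordering then makes the infimum a member.\<close>

lemma LS_cat_attained:
  fixes P :: "'a topology"
  assumes "LS_cat P Q h = enat k"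
  obtains U :: "nat \<Rightarrow> 'a set" where
    "\<And>i. i \<le> k \<Longrightarrow> openin P (U i)" "\<And>i. i \<le> k \<Longrightarrow> null_homotopic (subtopology P (U i)) Q h"
    "(\<Union>i\<le>k. U i) = topspace P"
proof -
  let ?A = "{enat k | k. \<exists>U :: nat \<Rightarrow> 'a set.
     (\<forall>i\<le>k. openin P (U i) \<and> null_homotopic (subtopology P (U i)) Q h) \<and>
     (\<Union>i\<le>k. U i) = topspace P}"
  have Inf_A: "Inf ?A = enat k" using assms by (simp add: LS_cat_def)
  have "?A \<noteq> {}"
  proof
    assume "?A = {}"
    then have "Inf ?A = \<infinity>" by (simp only: Inf_enat_def if_True simp_thms)
    with Inf_A show False by simp
  qed
  then have "Inf ?A \<in> ?A" unfolding Inf_enat_def by (metis (mono_tags, lifting) LeastI ex_in_conv)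
  then show thesis unfolding Inf_A using that by auto
qed

lemma LS_cat_power_map_le:
  assumes X: "normal_space X" and Y: "path_connected_space Y" and f: "continuous_map X Y f" and n: "0 < n"
  shows "LS_cat (power_space n X) (power_space n Y) (power_map n f) \<le> enat n * LS_cat X Y f"
proof (cases "LS_cat X Y f")
  case infinity
  \<comment> \<open>Positivity of \<open>n\<close> matters: zero times infinity is zero in
    \<open>enat\<close>.\<close>
  then show ?thesis using n by (simp add: imult_infinity_right zero_enat_def[symmetric] enat_0_iff)
next
  case (enat k)
  obtain U where U: "\<And>i. i \<le> k \<Longrightarrow> openin X (U i)"
      "\<And>i. i \<le> k \<Longrightarrow> null_homotopic (subtopology X (U i)) Y f" "(\<Union>i\<le>k. U i) = topspace X"
    using LS_cat_attained[OF enat] by blast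
  obtain G :: "nat \<Rightarrow> nat \<Rightarrow> 'a set" where G: "\<And>j i. i \<le> k \<Longrightarrow> openin X (G j i)"
    "\<And>j i. i \<le> k \<Longrightarrow> G j i \<subseteq> U i" "\<And>j. disjoint_family_on (G j) {..k}"
    "\<And>x. x \<in> topspace X \<Longrightarrow>
      finite {j. x \<notin> (\<Union>i\<le>k. G j i)} \<and> card {j. x \<notin> (\<Union>i\<le>k. G j i)} \<le> k"
    using normal_space_disjoint_refinements[OF X U(1,3)] by auto
  define V where "V j = (\<Union>i\<le>k. G j i)" for j
  \<comment> \<open>One endpoint for all pieces: the image under \<open>f\<close> of a point of
    \<open>X\<close>, or anything if \<open>X\<close> is empty.\<close>
  obtain y where y: "X \<noteq> trivial_topology \<Longrightarrow> y \<in> topspace Y"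
    using continuous_map_image_subset_topspace[OF f] null_topspace_iff_trivial[of X] by blast
  have hom: "homotopic_with (\<lambda>_. True) (subtopology X (V j)) Y f (\<lambda>_. y)" for j
    unfolding V_def
  proof (rule homotopic_const_disjoint_Union)
    fix i assume i: "i \<in> {..k}"
    have "homotopic_with (\<lambda>_. True) (subtopology X (U i)) Y f (\<lambda>_. y)"
      using i y by (intro null_homotopic_imp_homotopic_const U(2) Y) (auto simp: subtopology_trivial_iff)
    then have "homotopic_with (\<lambda>_. True) (subtopology (subtopology X (U i)) (G j i)) Y f (\<lambda>_. y)"
      by (rule homotopic_from_subtopology)
    then show "homotopic_with (\<lambda>_. True) (subtopology X (G j i)) Y f (\<lambda>_. y)"
      using G(2)[of i j] i by (simp add: subtopology_subtopology Int_absorb1)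
  qed (use G in auto)
  have "LS_cat (power_space n X) (power_space n Y) (power_map n f) \<le> enat (n * k)"
  proof (rule LS_cat_le)
    show "openin (power_space n X) (PiE {..<n} (\<lambda>_. V j))" for j
      using G(1) by (auto simp: power_space_def openin_PiE V_def)
    show "null_homotopic (subtopology (power_space n X) (PiE {..<n} (\<lambda>_. V j))) (power_space n Y) (power_map n f)" for j
      using hom by (rule null_homotopic_power_map)
    show "(\<Union>j\<le>n * k. PiE {..<n} (\<lambda>_. V j)) = topspace (power_space n X)"
    proof
      have "V j \<subseteq> topspace X" for j using G(1) openin_subset by (fastforce simp: V_def)
      then show "(\<Union>j\<le>n * k. PiE {..<n} (\<lambda>_. V j)) \<subseteq> topspace (power_space n X)"
        unfolding topspace_power_space by (intro UN_least PiE_mono)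
      show "topspace (power_space n X) \<subseteq> (\<Union>j\<le>n * k. PiE {..<n} (\<lambda>_. V j))"
      proof
        fix x assume x: "x \<in> topspace (power_space n X)"
        then have xi: "x i \<in> topspace X" if "i < n" for i using that by (auto simp: topspace_power_space)
        \<comment> \<open>The indices spoiled by some coordinate: at most \<open>k\<close> for each,
          so at most \<open>n * k\<close> of the \<open>n * k + 1\<close> available. A surviving
          \<open>j\<close> serves all coordinates at once.\<close>
        let ?B = "\<Union>i<n. {j. x i \<notin> V j}"
        have fin: "finite {j. x i \<notin> V j}" "card {j. x i \<notin> V j} \<le> k" if "i < n" for i
          using G(4)[OF xi[OF that]] by (simp_all add: V_def)
        have "card ?B \<le> (\<Sum>i<n. card {j. x i \<notin> V j})" by (rule card_UN_le) simp
        also have "\<dots> \<le> (\<Sum>i<n. k)" using fin(2) by (intro sum_mono) simp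
        finally have "card ?B < card {..n * k}" by simp
        moreover have "finite ?B" using fin(1) by blast
        ultimately have "\<not> {..n * k} \<subseteq> ?B" by (meson card_mono not_le)
        then obtain j where "j \<le> n * k" "\<forall>i<n. x i \<in> V j" by auto
        then show "x \<in> (\<Union>j\<le>n * k. PiE {..<n} (\<lambda>_. V j))"
          using x by (auto simp: topspace_power_space PiE_iff)
      qed
    qed
  qed
  then show ?thesis by (simp add: enat)
qed

section \<open>Topological complexity\<close>

text \<open>Every cover counted by \<open>LS_cat\<close> is counted by \<open>qscat\<close>, because
  in a path-connected \<open>P\<close> the null-homotopies can be steered to a chosen point of
  \<open>A\<close>.\<close>

lemma qscat_le_LS_cat:
  fixes B :: "'a topology"
  assumes P: "path_connected_space P" and A: "A \<subseteq> topspace P" "topspace B \<noteq> {} \<Longrightarrow> A \<noteq> {}"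
  shows "qscat B C P A h \<le> LS_cat B P h"
  unfolding qscat_def LS_cat_def
proof (rule Inf_superset_mono, clarify)
  fix k and U :: "nat \<Rightarrow> 'a set"
  assume U: "\<forall>i\<le>k. openin B (U i) \<and> null_homotopic (subtopology B (U i)) P h"
    and cover: "(\<Union>i\<le>k. U i) = topspace B"
  let ?T = "top_of_set {0..1::real}"
  obtain a where a: "topspace B \<noteq> {} \<Longrightarrow> a \<in> A" using A(2) by blast
  have "\<exists>H. continuous_map (prod_topology (subtopology B (U i)) ?T) P H \<and>
      (\<forall>v\<in>U i. H (v, 1) = h v \<and> H (v, 0) \<in> A)" if i: "i \<le> k" for i
  proof -
    have "homotopic_with (\<lambda>_. True) (subtopology B (U i)) P h (\<lambda>_. a)"
      using U i a A(1)
      by (intro null_homotopic_imp_homotopic_const P) (auto simp: subtopology_trivial_iff)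
    \<comment> \<open>The homotopy is reversed because \<open>qscat\<close> expects \<open>h\<close>
      at time 1; its arguments are swapped below to put time second.\<close>
    from homotopic_with_symD[OF this]
    obtain K where K: "continuous_map (prod_topology ?T (subtopology B (U i))) P K"
        "\<And>x. K (0, x) = a" "\<And>x. K (1, x) = h x"
      unfolding homotopic_with_def by auto
    have "continuous_map (prod_topology (subtopology B (U i)) ?T) (prod_topology ?T (subtopology B (U i)))
        (\<lambda>z. (snd z, fst z))"
      by (intro continuous_map_pairedI continuous_map_fst continuous_map_snd)
    from continuous_map_compose[OF this K(1)]
    have "continuous_map (prod_topology (subtopology B (U i)) ?T) P (\<lambda>z. K (snd z, fst z))"
      by (simp add: o_def)
    moreover have "a \<in> A" if "v \<in> U i" for v
      using a that U i openin_subset by blast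
    ultimately show ?thesis using K(2,3) by (intro exI[of _ "\<lambda>z. K (snd z, fst z)"]) auto
  qed
  then show "\<exists>m. enat k = enat m \<and> (\<exists>V :: nat \<Rightarrow> 'a set. (\<forall>i\<le>m. openin B (V i) \<and>
        (\<exists>H. continuous_map (prod_topology (subtopology B (V i)) ?T) P H \<and>
             (\<forall>v\<in>V i. H (v, 1) = h v \<and> H (v, 0) \<in> A))) \<and> (\<Union>i\<le>m. V i) = topspace B)"
    using U cover by blast
qed

text \<open>Homotopies are transported along \<open>\<iota>\<close>, which repeats coordinate 0, and
  \<open>\<rho>\<close>, which drops the last coordinate:
  \<open>\<rho> (power_map (Suc n) f (\<iota> x)) = power_map n f x\<close>, and
  \<open>\<rho>\<close> sends the diagonal to the diagonal.\<close>

lemma TC_le_TC_Suc: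
  assumes n: "0 < n"
  shows "TC n X Y f \<le> TC (Suc n) X Y f"
  unfolding TC_def qscat_def
proof (rule Inf_superset_mono, clarify)
  fix m and V :: "nat \<Rightarrow> (nat \<Rightarrow> 'a) set"
  let ?T = "top_of_set {0..1::real}"
  let ?X = "power_space n X" and ?X' = "power_space (Suc n) X"
  let ?Y = "power_space n Y" and ?Y' = "power_space (Suc n) Y"
  assume V: "\<forall>i\<le>m. openin ?X' (V i) \<and>
      (\<exists>H. continuous_map (prod_topology (subtopology ?X' (V i)) ?T) ?Y' H \<and>
        (\<forall>v\<in>V i. H (v, 1) = power_map (Suc n) f v \<and> H (v, 0) \<in> diagonal_map (Suc n) ` topspace Y))"
    and cover: "(\<Union>i\<le>m. V i) = topspace ?X'"
  \<comment> \<open>The new last coordinate copies coordinate 0, which exists because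
    \<open>0 < n\<close>.\<close>
  define \<iota> where "\<iota> x = (\<lambda>i\<in>{..<Suc n}. x (if i < n then i else 0))" for x :: "nat \<Rightarrow> 'a"
  define \<rho> where "\<rho> y = restrict y {..<n}" for y :: "nat \<Rightarrow> 'b"
  have \<iota>: "continuous_map ?X ?X' \<iota>"
    unfolding power_space_def continuous_map_componentwise
  proof (intro conjI ballI)
    show "\<iota> ` topspace (product_topology (\<lambda>_. X) {..<n}) \<subseteq> extensional {..<Suc n}"
      by (auto simp: \<iota>_def)
    show "continuous_map (product_topology (\<lambda>_. X) {..<n}) X (\<lambda>x. \<iota> x i)" if "i \<in> {..<Suc n}" for i
      using that n by (auto simp: \<iota>_def intro!: continuous_map_product_projection)
  qed
  have \<rho>: "continuous_map ?Y' ?Y \<rho>"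
    unfolding power_space_def continuous_map_componentwise
  proof (intro conjI ballI)
    show "\<rho> ` topspace (product_topology (\<lambda>_. Y) {..<Suc n}) \<subseteq> extensional {..<n}"
      by (auto simp: \<rho>_def)
    show "continuous_map (product_topology (\<lambda>_. Y) {..<Suc n}) Y (\<lambda>y. \<rho> y i)" if "i \<in> {..<n}" for i
      using that by (auto simp: \<rho>_def intro!: continuous_map_product_projection)
  qed
  define W where "W i = {x \<in> topspace ?X. \<iota> x \<in> V i}" for i
  have "openin ?X (W i)" if "i \<le> m" for i
    unfolding W_def using V that by (intro openin_continuous_map_preimage[OF \<iota>]) blast
  moreover have "\<exists>H. continuous_map (prod_topology (subtopology ?X (W i)) ?T) ?Y H \<and>
      (\<forall>v\<in>W i. H (v, 1) = power_map n f v \<and> H (v, 0) \<in> diagonal_map n ` topspace Y)" if i: "i \<le> m" for i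
  proof -
    obtain H where H: "continuous_map (prod_topology (subtopology ?X' (V i)) ?T) ?Y' H"
        "\<And>v. v \<in> V i \<Longrightarrow> H (v, 1) = power_map (Suc n) f v"
        "\<And>v. v \<in> V i \<Longrightarrow> H (v, 0) \<in> diagonal_map (Suc n) ` topspace Y"
      using V i by metis
    have "continuous_map (subtopology ?X (W i)) (subtopology ?X' (V i)) \<iota>"
      unfolding continuous_map_in_subtopology
      using continuous_map_from_subtopology[OF \<iota>] by (auto simp: W_def)
    then have "continuous_map (prod_topology (subtopology ?X (W i)) ?T)
        (prod_topology (subtopology ?X' (V i)) ?T) (\<lambda>z. (\<iota> (fst z), snd z))"
      using continuous_map_compose[OF continuous_map_fst]
      by (intro continuous_map_pairedI continuous_map_snd) (fastforce simp: o_def)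
    from continuous_map_compose[OF continuous_map_compose[OF this H(1)] \<rho>]
    have "continuous_map (prod_topology (subtopology ?X (W i)) ?T) ?Y (\<lambda>z. \<rho> (H (\<iota> (fst z), snd z)))"
      by (simp add: o_def)
    moreover have "\<rho> (power_map (Suc n) f (\<iota> x)) = power_map n f x" for x
      by (auto simp: \<rho>_def power_map_def \<iota>_def fun_eq_iff)
    moreover have "\<rho> (diagonal_map (Suc n) y) = diagonal_map n y" for y
      by (auto simp: \<rho>_def diagonal_map_def fun_eq_iff)
    then have "\<rho> w \<in> diagonal_map n ` topspace Y" if "w \<in> diagonal_map (Suc n) ` topspace Y" for w
      using that by auto
    ultimately show ?thesis
      using H(2,3) by (intro exI[of _ "\<lambda>z. \<rho> (H (\<iota> (fst z), snd z))"]) (auto simp: W_def)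
  qed
  moreover have "(\<Union>i\<le>m. W i) = topspace ?X"
  proof -
    have "\<iota> x \<in> topspace ?X'" if "x \<in> topspace ?X" for x
      using continuous_map_image_subset_topspace[OF \<iota>] that by blast
    then show ?thesis using cover by (auto simp: W_def)
  qed
  ultimately show "\<exists>k. enat m = enat k \<and> (\<exists>V :: nat \<Rightarrow> (nat \<Rightarrow> 'a) set. (\<forall>i\<le>k. openin ?X (V i) \<and>
      (\<exists>H. continuous_map (prod_topology (subtopology ?X (V i)) ?T) ?Y H \<and>
        (\<forall>v\<in>V i. H (v, 1) = power_map n f v \<and> H (v, 0) \<in> diagonal_map n ` topspace Y))) \<and>
      (\<Union>i\<le>k. V i) = topspace ?X)"
    by blast
qed

lemma TC_le_LS_cat_power_map:
  assumes "path_connected_space Y" and f: "continuous_map X Y f" and n: "0 < n"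
  shows "TC n X Y f \<le> LS_cat (power_space n X) (power_space n Y) (power_map n f)"
  unfolding TC_def
proof (rule qscat_le_LS_cat)
  show "path_connected_space (power_space n Y)" using assms(1) by (rule path_connected_power_space)
  show "diagonal_map n ` topspace Y \<subseteq> topspace (power_space n Y)"
    by (auto simp: topspace_power_space diagonal_map_def)
  assume "topspace (power_space n X) \<noteq> {}"
  \<comment> \<open>The zeroth power is a single point even over an empty space, so
    \<open>0 < n\<close> is what transfers nonemptiness to \<open>X\<close>.\<close>
  then have "topspace X \<noteq> {}" using n by (auto simp: topspace_power_space PiE_eq_empty_iff)
  then show "diagonal_map n ` topspace Y \<noteq> {}"
    using continuous_map_image_subset_topspace[OF f] by blast
qed

theorem proposition3p7:
  fixes X :: "'a topology" and Y :: "'b topology" and f :: "'a \<Rightarrow> 'b"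
  assumes "CW_space X" and "path_connected_space X"
    and "CW_space Y" and "path_connected_space Y"
    and "continuous_map X Y f"
  shows "(\<forall>n\<ge>2.
            TC n X Y f \<le> TC (n + 1) X Y f \<and>
            TC (n + 1) X Y f
              \<le> LS_cat (power_space (n + 1) X) (power_space (n + 1) Y) (power_map (n + 1) f) \<and>
            LS_cat (power_space (n + 1) X) (power_space (n + 1) Y) (power_map (n + 1) f)
              \<le> enat (n + 1) * LS_cat X Y f) \<and>
         (LS_cat X Y f \<noteq> \<infinity> \<longrightarrow>
            (\<forall>n\<ge>2. TC n X Y f \<noteq> \<infinity>) \<and>
            (\<lambda>n. real (the_enat (TC n X Y f))) \<in> O(\<lambda>n. real n))"
proof -
  have cat: "LS_cat (power_space n X) (power_space n Y) (power_map n f) \<le> enat n * LS_cat X Y f"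
    if "0 < n" for n
    using CW_space_imp_normal_space[OF assms(1)] assms(4,5) that by (rule LS_cat_power_map_le)
  have TC_cat: "TC n X Y f \<le> LS_cat (power_space n X) (power_space n Y) (power_map n f)"
    if "0 < n" for n
    using assms(4,5) that by (rule TC_le_LS_cat_power_map)
  have chain: "TC n X Y f \<le> TC (n + 1) X Y f" if "0 < n" for n
    using TC_le_TC_Suc[OF that, of X Y f] by simp
  have growth: "(\<forall>n\<ge>2. TC n X Y f \<noteq> \<infinity>) \<and> (\<lambda>n. real (the_enat (TC n X Y f))) \<in> O(\<lambda>n. real n)"
    if finite: "LS_cat X Y f \<noteq> \<infinity>"
  proof -
    obtain k where k: "LS_cat X Y f = enat k" using finite by (cases "LS_cat X Y f") auto
    \<comment> \<open>Comparing with the category of the \<open>n\<close>-th power itself gives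
      \<open>n * k\<close>, where passing through \<open>TC (n + 1) X Y f\<close> would give
      \<open>(n + 1) * k\<close>.\<close>
    have le: "TC n X Y f \<le> enat (n * k)" if "0 < n" for n
      using order_trans[OF TC_cat cat, OF that that] by (simp add: k)
    \<comment> \<open>Finiteness ensures that \<open>the_enat\<close> returns the actual value in
      the asymptotic bound.\<close>
    have fin: "TC n X Y f \<noteq> \<infinity>" if "n \<ge> 2" for n
      using le[of n] that by (cases "TC n X Y f") auto
    have "the_enat (TC n X Y f) \<le> k * n" if "0 < n" for n
      using le[OF that] by (cases "TC n X Y f") (auto simp: mult.commute)
    then have "norm (real (the_enat (TC n X Y f))) \<le> real k * norm (real n)" if "0 < n" for n
      using that by (simp flip: of_nat_mult)
    then have "(\<lambda>n. real (the_enat (TC n X Y f))) \<in> O(\<lambda>n. real n)"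
      by (intro bigoI[of _ "real k"] eventually_mono[OF eventually_gt_at_top[of 0]])
    with fin show ?thesis by blast
  qed
  show ?thesis
    using chain TC_cat cat growth by simp
qed

end
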